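(* Let $F(X)$ be a free group with set of free generators $X$, and let $\varphi \in \mathrm{Aut}(F(X))$ be such that $\varphi^n \in \mathrm{Int}(F(X))$ for some positive integer $n$. Let $$F_\varphi(X) = \langle X, t \;\|\; t^{-1} x t = \varphi(x),\ x \in X\rangle .$$ Let $f \in F(X)$ be such that $\varphi^n(x) = f^{-1} x f$ for all $x \in X$. Let $P$ be a field, let $\sigma : F(X) \to \mathrm{GL}_m(P)$ be a faithful linear representation of $F(X)$, and let $s \in P^*$ be an arbitrary element of infinite order. Define on the generators $mn \times mn$ matrices, written as $n \times n$ block matrices with blocks of size $m \times m$, by $$ t^{\tau} = \left( \begin{array}{ccccc} \mathbf{0} & E_m & \mathbf{0} & \cdots & \mathbf{0} \\ \mathbf{0} & \mathbf{0} & E_m & \cdots & \mathbf{0} \\ \vdots & & & \ddots & \vdots \\ \mathbf{0} & \mathbf{0} & \mathbf{0} & \cdots & E_m \\ s f^{\sigma} & \mathbf{0} & \mathbf{0} & \cdots & \mathbf{0} \end{array} \right), $$ $$ x^{\tau} = \mathrm{diag}\left( x^{\sigma},\ (\varphi^{-1}(x))^{\sigma},\ \ldots,\ (\varphi^{-n+2}(x))^{\sigma},\ (\varphi^{-n+1}(x))^{\sigma}\right), \quad x \in X. $$ Then $\tau$ defines a faithful linear representation $\tau : F_\varphi(X) \to \mathrm{GL}_{mn}(P)$.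
   Context: $\mathrm{Int}(F(X))$ is the group of inner automorphisms of $F(X)$. $g^\sigma$ denotes the image of $g$ under $\sigma$ (and similarly for $\tau$). $\mathbf{0}$ and $E_m$ are the zero and identity $m\times m$ matrices. In $t^\tau$ the only nonzero blocks are $E_m$ at positions $(i,i+1)$, $i=1,\dots,n-1$, and $s f^\sigma$ at position $(n,1)$; in particular for $n=1$ one has $t^\tau = s f^\sigma$. In $x^\tau$ the diagonal block at position $(i,i)$ is $(\varphi^{-i+1}(x))^\sigma$. The HNN-extension $F_\varphi(X)$ is the group given by the displayed presentation.
   Formalization: Faithfulness of τ is claimed only when X is not a singleton; for X={x}, φ=id, n=1, f=1, m=1, P=Q, x^σ=2, s=2 the statement fails since x^τ=t^τ. That τ is a representation is proved for every X. *)

theory Defs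
  imports "HOL-Algebra.Bij" "Jordan_Normal_Form.Matrix"
begin

section \<open>Groups given by generators and relations\<close>

text \<open>A letter is a generator tagged with \<^term>\<open>True\<close>, or its formal inverse, tagged
  with \<^term>\<open>False\<close>.\<close>

type_synonym 'a word = "('a \<times> bool) list"

definition words :: "'a set \<Rightarrow> 'a word set" where
  "words S = lists (S \<times> UNIV)"

text \<open>The least congruence on words over \<open>S\<close> that cancels adjacent inverse letters and
  identifies \<open>l\<close> with \<open>r\<close> for every relation \<open>(l, r) \<in> R\<close>.\<close>

inductive_set pres_rel :: "'a set \<Rightarrow> ('a word \<times> 'a word) set \<Rightarrow> ('a word \<times> 'a word) set"
  for S R where
  refl: "w \<in> words S \<Longrightarrow> (w, w) \<in> pres_rel S R"
| sym: "(v, w) \<in> pres_rel S R \<Longrightarrow> (w, v) \<in> pres_rel S R"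
| trans: "(u, v) \<in> pres_rel S R \<Longrightarrow> (v, w) \<in> pres_rel S R \<Longrightarrow> (u, w) \<in> pres_rel S R"
| cancel: "u \<in> words S \<Longrightarrow> v \<in> words S \<Longrightarrow> x \<in> S \<Longrightarrow>
    (u @ [(x, b), (x, \<not> b)] @ v, u @ v) \<in> pres_rel S R"
| relation: "u \<in> words S \<Longrightarrow> v \<in> words S \<Longrightarrow> (l, r) \<in> R \<Longrightarrow> l \<in> words S \<Longrightarrow> r \<in> words S \<Longrightarrow>
    (u @ l @ v, u @ r @ v) \<in> pres_rel S R"

definition presented_group :: "'a set \<Rightarrow> ('a word \<times> 'a word) set \<Rightarrow> 'a word set monoid" where
  "presented_group S R =
    \<lparr>carrier = words S // pres_rel S R,
     monoid.mult = (\<lambda>A B. \<Union>u\<in>A. \<Union>v\<in>B. pres_rel S R `` {u @ v}),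
     monoid.one = pres_rel S R `` {[]}\<rparr>"

definition pres_gen :: "'a set \<Rightarrow> ('a word \<times> 'a word) set \<Rightarrow> 'a \<Rightarrow> 'a word set" where
  "pres_gen S R x = pres_rel S R `` {[(x, True)]}"

lemma words_simps [simp]:
  "[] \<in> words S"
  "a # w \<in> words S \<longleftrightarrow> fst a \<in> S \<and> w \<in> words S"
  "u @ v \<in> words S \<longleftrightarrow> u \<in> words S \<and> v \<in> words S"
  by (cases a; auto simp: words_def)+

lemma pres_rel_words: "(u, v) \<in> pres_rel S R \<Longrightarrow> u \<in> words S \<and> v \<in> words S"
  by (induction rule: pres_rel.induct) auto

lemma equiv_pres_rel: "equiv (words S) (pres_rel S R)"
proof (rule equivI)
  show "pres_rel S R \<subseteq> words S \<times> words S"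
    using pres_rel_words by fastforce
  show "refl_on (words S) (pres_rel S R)"
    by (simp add: refl_on_def pres_rel.refl)
  show "sym (pres_rel S R)"
    by (rule symI) (rule pres_rel.sym)
  show "trans (pres_rel S R)"
    by (rule transI) (rule pres_rel.trans)
qed

lemma pres_rel_context:
  assumes "(u, v) \<in> pres_rel S R" "p \<in> words S" "q \<in> words S"
  shows "(p @ u @ q, p @ v @ q) \<in> pres_rel S R"
  using assms(1)
proof (induction rule: pres_rel.induct)
  case (cancel u v x b)
  then show ?case
    using pres_rel.cancel[of "p @ u" S "v @ q" x b R] assms by simp
next
  case (relation u v l r)
  then show ?case
    using pres_rel.relation[of "p @ u" S "v @ q" l r R] assms by simp
next
  case (refl w)
  then show ?case using assms by (simp add: pres_rel.refl)
next
  case (sym v w)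
  show ?case by (rule pres_rel.sym) (rule sym.IH)
next
  case (trans u v w)
  show ?case by (rule pres_rel.trans) (rule trans.IH)+
qed

lemma pres_rel_append:
  assumes "(u, u') \<in> pres_rel S R" "(v, v') \<in> pres_rel S R"
  shows "(u @ v, u' @ v') \<in> pres_rel S R"
proof (rule pres_rel.trans)
  show "(u @ v, u' @ v) \<in> pres_rel S R"
    using pres_rel_context[OF assms(1), of "[]" v] pres_rel_words[OF assms(2)] by simp
  show "(u' @ v, u' @ v') \<in> pres_rel S R"
    using pres_rel_context[OF assms(2), of u' "[]"] pres_rel_words[OF assms(1)] by simp
qed

lemma presented_group_mult:
  assumes "u \<in> words S" "v \<in> words S"
  shows "pres_rel S R `` {u} \<otimes>\<^bsub>presented_group S R\<^esub> pres_rel S R `` {v} =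
    pres_rel S R `` {u @ v}"
proof -
  let ?c = "\<lambda>w. pres_rel S R `` {w}"
  have const: "?c (u' @ v') = ?c (u @ v)" if "u' \<in> ?c u" "v' \<in> ?c v" for u' v'
    using equiv_class_eq[OF equiv_pres_rel pres_rel_append[of u u' S R v v']] that by simp
  have "?c u \<otimes>\<^bsub>presented_group S R\<^esub> ?c v = (\<Union>u'\<in>?c u. \<Union>v'\<in>?c v. ?c (u' @ v'))"
    by (simp add: presented_group_def)
  also have "\<dots> = (\<Union>u'\<in>?c u. \<Union>v'\<in>?c v. ?c (u @ v))"
    by (intro SUP_cong HOL.refl const)
  also have "\<dots> = ?c (u @ v)"
    using equiv_class_self[OF equiv_pres_rel assms(1)] equiv_class_self[OF equiv_pres_rel assms(2)]
    by blast
  finally show ?thesis .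
qed

lemma words_inverse: "w \<in> words S \<Longrightarrow> rev (map (apsnd Not) w) \<in> words S"
  by (induction w) auto

lemma pres_rel_inverse:
  assumes "w \<in> words S"
  shows "(rev (map (apsnd Not) w) @ w, []) \<in> pres_rel S R"
  using assms
proof (induction w)
  case (Cons a w)
  obtain x b where a: "a = (x, b)" by (cases a)
  have inv: "rev (map (apsnd Not) w) \<in> words S"
    using Cons.prems by (simp add: words_inverse)
  have "(rev (map (apsnd Not) w) @ [(x, \<not> b), (x, \<not> \<not> b)] @ w,
      rev (map (apsnd Not) w) @ w) \<in> pres_rel S R"
    using Cons.prems inv a by (intro pres_rel.cancel) auto
  moreover have "(rev (map (apsnd Not) w) @ w, []) \<in> pres_rel S R"
    using Cons by simp
  ultimately show ?case
    using a pres_rel.trans by fastforce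
qed (simp add: pres_rel.refl)

theorem group_presented_group: "group (presented_group S R)"
proof (rule groupI)
  let ?G = "presented_group S R"
  have carrier: "\<exists>w\<in>words S. A = pres_rel S R `` {w}" if "A \<in> carrier ?G" for A
    using that by (auto simp: presented_group_def elim: quotientE)
  have closed: "pres_rel S R `` {w} \<in> carrier ?G" if "w \<in> words S" for w
    using that by (simp add: presented_group_def quotientI)
  have one: "\<one>\<^bsub>?G\<^esub> = pres_rel S R `` {[]}"
    by (simp add: presented_group_def)
  show "A \<otimes>\<^bsub>?G\<^esub> B \<in> carrier ?G" if "A \<in> carrier ?G" "B \<in> carrier ?G" for A B
    using carrier[OF that(1)] carrier[OF that(2)] by (auto simp: presented_group_mult closed)
  show "\<one>\<^bsub>?G\<^esub> \<in> carrier ?G"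
    by (simp add: one closed)
  show "A \<otimes>\<^bsub>?G\<^esub> B \<otimes>\<^bsub>?G\<^esub> C = A \<otimes>\<^bsub>?G\<^esub> (B \<otimes>\<^bsub>?G\<^esub> C)"
    if "A \<in> carrier ?G" "B \<in> carrier ?G" "C \<in> carrier ?G" for A B C
    using carrier[OF that(1)] carrier[OF that(2)] carrier[OF that(3)]
    by (auto simp: presented_group_mult)
  show "\<one>\<^bsub>?G\<^esub> \<otimes>\<^bsub>?G\<^esub> A = A" if "A \<in> carrier ?G" for A
    using carrier[OF that] by (auto simp: presented_group_mult one)
  show "\<exists>B\<in>carrier ?G. B \<otimes>\<^bsub>?G\<^esub> A = \<one>\<^bsub>?G\<^esub>" if A: "A \<in> carrier ?G" for A
  proof -
    obtain w where w: "w \<in> words S" "A = pres_rel S R `` {w}"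
      using carrier[OF A] by blast
    have inv: "rev (map (apsnd Not) w) \<in> words S"
      using w(1) by (rule words_inverse)
    have "pres_rel S R `` {rev (map (apsnd Not) w)} \<otimes>\<^bsub>?G\<^esub> A = \<one>\<^bsub>?G\<^esub>"
      using equiv_class_eq[OF equiv_pres_rel pres_rel_inverse[OF w(1)]] w inv
      by (simp add: presented_group_mult one)
    then show ?thesis
      using closed[OF inv] by blast
  qed
qed


section \<open>Free groups and mapping tori of free-group automorphisms\<close>

abbreviation free_group :: "'a set \<Rightarrow> 'a word set monoid" where
  "free_group X \<equiv> presented_group X {}"

abbreviation free_gen :: "'a set \<Rightarrow> 'a \<Rightarrow> 'a word set" where
  "free_gen X \<equiv> pres_gen X {}"

text \<open>The stable letter \<open>t\<close> is \<^term>\<open>None\<close> and \<open>x \<in> X\<close> is \<^term>\<open>Some x\<close>. Elements of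
  \<^term>\<open>free_group X\<close> are classes of words, so the relation \<open>t\<^sup>-\<^sup>1 x t = \<phi>(x)\<close> is imposed for
  every word \<open>w\<close> that represents \<open>\<phi>(x)\<close>; these words agree already by free cancellation.\<close>

definition hnn_gens :: "'a set \<Rightarrow> 'a option set" where
  "hnn_gens X = insert None (Some ` X)"

definition hnn_rels ::
  "'a set \<Rightarrow> ('a word set \<Rightarrow> 'a word set) \<Rightarrow> ('a option word \<times> 'a option word) set" where
  "hnn_rels X \<phi> =
    {([(None, False), (Some x, True), (None, True)], map (apfst Some) w) |x w.
       x \<in> X \<and> w \<in> \<phi> (free_gen X x)}"

abbreviation hnn_group ::
  "'a set \<Rightarrow> ('a word set \<Rightarrow> 'a word set) \<Rightarrow> 'a option word set monoid" where
  "hnn_group X \<phi> \<equiv> presented_group (hnn_gens X) (hnn_rels X \<phi>)"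

abbreviation hnn_gen ::
  "'a set \<Rightarrow> ('a word set \<Rightarrow> 'a word set) \<Rightarrow> 'a option \<Rightarrow> 'a option word set" where
  "hnn_gen X \<phi> \<equiv> pres_gen (hnn_gens X) (hnn_rels X \<phi>)"


section \<open>Inner automorphisms\<close>

text \<open>Restricted to the carrier, as are all elements of \<^term>\<open>AutoGroup G\<close>.\<close>

definition Inn :: "('a, 'b) monoid_scheme \<Rightarrow> ('a \<Rightarrow> 'a) set" where
  "Inn G = (\<lambda>g. \<lambda>x\<in>carrier G. inv\<^bsub>G\<^esub> g \<otimes>\<^bsub>G\<^esub> x \<otimes>\<^bsub>G\<^esub> g) ` carrier G"


section \<open>General linear groups and block matrices\<close>

definition GL :: "nat \<Rightarrow> 'p::field mat monoid" where
  "GL m = units_of (ring_mat TYPE('p) m ())"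

text \<open>\<^term>\<open>block_mat n m B\<close> has \<open>n \<times> n\<close> blocks of size \<open>m \<times> m\<close>; both block indices of \<open>B\<close>
  run from \<open>0\<close> to \<open>n - 1\<close>.\<close>

definition block_mat :: "nat \<Rightarrow> nat \<Rightarrow> (nat \<Rightarrow> nat \<Rightarrow> 'p mat) \<Rightarrow> 'p mat" where
  "block_mat n m B =
    mat (m * n) (m * n) (\<lambda>(i, j). B (i div m) (j div m) $$ (i mod m, j mod m))"

definition block_shift_mat :: "nat \<Rightarrow> nat \<Rightarrow> 'p::field \<Rightarrow> 'p mat \<Rightarrow> 'p mat" where
  "block_shift_mat n m s A = block_mat n m (\<lambda>i j.
     if j = i + 1 then 1\<^sub>m m
     else if i = n - 1 \<and> j = 0 then s \<cdot>\<^sub>m A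
     else 0\<^sub>m m m)"

definition block_diag_mat :: "nat \<Rightarrow> nat \<Rightarrow> (nat \<Rightarrow> 'p::field mat) \<Rightarrow> 'p mat" where
  "block_diag_mat n m D = block_mat n m (\<lambda>i j. if i = j then D i else 0\<^sub>m m m)"

end

theory Submission
  imports Defs "HOL-Algebra.Coset"
begin

(* T^n is block diagonal with all diagonal blocks s * sigma f, and every element of the HNN extension
   has the form g t^k with g in F(X). A kernel element therefore yields T^l = tau c with l >= 0 and
   c in F(X); comparing block supports gives l = n q, and comparing first blocks gives
   s^q * sigma (f^q) = sigma c. Hence sigma maps c f^(-q) to the scalar matrix s^q, so c f^(-q) is
   central in F(X) and, unless X is a singleton, trivial. Then s^q = 1, so q = 0 and c = 1. *)

section \<open>Homomorphisms from presented groups\<close>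

text \<open>By the choice of f, the element t^n f^-1 centralises F(X), so \<sigma> extends to the
  subgroup generated by F(X) and t^n by sending t^n f^-1 to the scalar s. The matrices are those of
  the representation induced from this subgroup of index n, on the cosets of 1, t, ..., t^(n-1).
  This explains the twists by \<phi>^-i on the diagonal and the single block that carries s. The
  exclusion of a one-element X is forced. Take X = {x}, m = n = 1, \<phi> the identity, \<sigma> x =
  s and f = x^-1: then t is sent to s * s^-1 = 1, although t has infinite order. A power of s can
  thus be cancelled by an image of \<sigma> that is itself scalar, and only a trivial centre
  prevents this. The condition \<open>card X \<noteq> 1\<close> admits the empty set and, since
  \<open>card\<close> is 0 on them, all infinite sets.\<close>

definition word_eval :: "('b, 'c) monoid_scheme \<Rightarrow> ('a \<Rightarrow> 'b) \<Rightarrow> 'a word \<Rightarrow> 'b" where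
  "word_eval G h w =
    foldr (\<lambda>(x, b) g. (if b then h x else inv\<^bsub>G\<^esub> h x) \<otimes>\<^bsub>G\<^esub> g) w \<one>\<^bsub>G\<^esub>"

lemma word_eval_simps [simp]:
  "word_eval G h [] = \<one>\<^bsub>G\<^esub>"
  "word_eval G h ((x, b) # w) = (if b then h x else inv\<^bsub>G\<^esub> h x) \<otimes>\<^bsub>G\<^esub> word_eval G h w"
  by (simp_all add: word_eval_def)

lemma word_eval_map_apfst: "word_eval G h (map (apfst g) w) = word_eval G (h \<circ> g) w"
  by (induction w) auto

lemma word_eval_cong:
  "w \<in> words S \<Longrightarrow> (\<And>x. x \<in> S \<Longrightarrow> h x = h' x) \<Longrightarrow> word_eval G h w = word_eval G h' w"
  by (induction w) auto

lemma (in group) word_eval_closed [simp]: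
  assumes "h \<in> S \<rightarrow> carrier G" "w \<in> words S"
  shows "word_eval G h w \<in> carrier G"
  using assms(2)
proof (induction w)
  case (Cons a w)
  then have "h (fst a) \<in> carrier G" using assms(1) by auto
  then show ?case using Cons by (cases a) simp
qed simp

lemma (in group) word_eval_append:
  assumes "h \<in> S \<rightarrow> carrier G" "u \<in> words S" "v \<in> words S"
  shows "word_eval G h (u @ v) = word_eval G h u \<otimes> word_eval G h v"
  using assms(2)
proof (induction u)
  case Nil
  then show ?case using assms by simp
next
  case (Cons a u)
  obtain x b where a: "a = (x, b)" by (cases a)
  have "h x \<in> carrier G" "word_eval G h u \<in> carrier G" "word_eval G h v \<in> carrier G"
    using assms Cons.prems a by auto
  then show ?case using Cons a by (simp add: m_assoc)
qed

lemma (in group_hom) hom_word_eval: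
  assumes "k \<in> S \<rightarrow> carrier G" "w \<in> words S"
  shows "h (word_eval G k w) = word_eval H (h \<circ> k) w"
  using assms(2)
proof (induction w)
  case (Cons a w)
  obtain x b where a: "a = (x, b)" by (cases a)
  have "k x \<in> carrier G" "word_eval G k w \<in> carrier G"
    using assms Cons.prems a by auto
  then show ?case using Cons a by simp
qed simp

section \<open>Classes, generators and the universal property of a presented group\<close>

lemma pres_class_in_carrier [simp]:
  "w \<in> words S \<Longrightarrow> pres_rel S R `` {w} \<in> carrier (presented_group S R)"
  by (simp add: presented_group_def quotientI)

lemma pres_gen_in_carrier [simp]:
  "x \<in> S \<Longrightarrow> pres_gen S R x \<in> carrier (presented_group S R)"
  by (simp add: pres_gen_def)

lemma presented_group_one: "\<one>\<^bsub>presented_group S R\<^esub> = pres_rel S R `` {[]}"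
  by (simp add: presented_group_def)

lemma presented_group_cases:
  assumes "g \<in> carrier (presented_group S R)"
  obtains w where "w \<in> words S" "g = pres_rel S R `` {w}"
  using assms by (auto simp: presented_group_def elim: quotientE)

lemma inv_pres_gen:
  assumes "x \<in> S"
  shows "inv\<^bsub>presented_group S R\<^esub> pres_gen S R x = pres_rel S R `` {[(x, False)]}"
proof -
  interpret P: group "presented_group S R" by (rule group_presented_group)
  have "([] @ [(x, False), (x, \<not> False)] @ [], [] @ []) \<in> pres_rel S R"
    by (rule pres_rel.cancel) (use assms in auto)
  then have "pres_rel S R `` {[(x, False)]} \<otimes>\<^bsub>presented_group S R\<^esub> pres_gen S R x
      = \<one>\<^bsub>presented_group S R\<^esub>"
    using assms equiv_class_eq[OF equiv_pres_rel]
    by (fastforce simp: pres_gen_def presented_group_mult presented_group_one)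
  then show ?thesis
    using assms by (intro P.inv_equality) simp_all
qed

text \<open>Turns every class into an evaluation at the generators, so that statements about
  homomorphisms out of a presented group become inductions on words.\<close>

lemma word_eval_pres_gen:
  "w \<in> words S \<Longrightarrow> word_eval (presented_group S R) (pres_gen S R) w = pres_rel S R `` {w}"
proof (induction w)
  case (Cons a w)
  obtain x b where "a = (x, b)" by (cases a)
  then show ?case
    using Cons presented_group_mult[of "[(x, b)]" S w R]
    by (cases b) (simp_all add: inv_pres_gen, simp add: pres_gen_def)
qed (simp add: presented_group_one)

lemma hom_pres_class:
  assumes "group G" "\<kappa> \<in> hom (presented_group S R) G" "w \<in> words S"
  shows "\<kappa> (pres_rel S R `` {w}) = word_eval G (\<kappa> \<circ> pres_gen S R) w"
proof -
  interpret group_hom "presented_group S R" G \<kappa>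
    using assms by (simp add: group_hom_def group_hom_axioms_def group_presented_group)
  show ?thesis
    using hom_word_eval[of "pres_gen S R" S w] assms by (simp add: word_eval_pres_gen)
qed

text \<open>The device that extends each identity given on generators to the whole group: the
  conjugation rule for t, the formula for \<phi>^n, and the agreement of two representations on
  F(X).\<close>

lemma presented_group_hom_eqI:
  assumes "group G" "\<kappa> \<in> hom (presented_group S R) G" "\<kappa>' \<in> hom (presented_group S R) G"
    and "\<And>x. x \<in> S \<Longrightarrow> \<kappa> (pres_gen S R x) = \<kappa>' (pres_gen S R x)"
    and "g \<in> carrier (presented_group S R)"
  shows "\<kappa> g = \<kappa>' g"
proof -
  obtain w where "w \<in> words S" "g = pres_rel S R `` {w}"
    using assms(5) by (rule presented_group_cases)
  then show ?thesis
    using assms by (auto simp: hom_pres_class intro!: word_eval_cong)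
qed

text \<open>Cancellation is automatic in a group and the congruence is generated by it together with
  \<open>R\<close>, so only the relations themselves need checking.\<close>

lemma (in group) word_eval_pres_rel:
  assumes h: "h \<in> S \<rightarrow> carrier G"
    and rels: "\<And>l r. (l, r) \<in> R \<Longrightarrow> l \<in> words S \<Longrightarrow> r \<in> words S \<Longrightarrow>
      word_eval G h l = word_eval G h r"
    and "(u, v) \<in> pres_rel S R"
  shows "word_eval G h u = word_eval G h v"
  using assms(3)
proof (induction rule: pres_rel.induct)
  case (cancel u v x b)
  have "h x \<in> carrier G" "word_eval G h v \<in> carrier G"
    using h cancel by auto
  then show ?case
    using cancel h by (cases b) (simp_all add: word_eval_append m_assoc[symmetric])
next
  case (relation u v l r)
  then show ?case using h rels[of l r] by (simp add: word_eval_append)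
qed simp_all

lemma presented_group_lift:
  assumes "group G" and h: "h \<in> S \<rightarrow> carrier G"
    and rels: "\<And>l r. (l, r) \<in> R \<Longrightarrow> l \<in> words S \<Longrightarrow> r \<in> words S \<Longrightarrow>
      word_eval G h l = word_eval G h r"
  obtains \<kappa> where "\<kappa> \<in> hom (presented_group S R) G"
    "\<And>x. x \<in> S \<Longrightarrow> \<kappa> (pres_gen S R x) = h x"
proof -
  interpret group G by fact
  \<comment> \<open>The representative is arbitrary; independence of the choice is
    \<open>word_eval_pres_rel\<close>.\<close>
  define \<kappa> where "\<kappa> A = word_eval G h (SOME w. w \<in> A)" for A
  have \<kappa>: "\<kappa> (pres_rel S R `` {w}) = word_eval G h w" if "w \<in> words S" for w
  proof -
    have "(SOME v. v \<in> pres_rel S R `` {w}) \<in> pres_rel S R `` {w}"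
      using equiv_class_self[OF equiv_pres_rel that] by (rule someI)
    then show ?thesis
      using word_eval_pres_rel[OF h rels] by (force simp: \<kappa>_def)
  qed
  have "\<kappa> \<in> hom (presented_group S R) G"
  proof (rule homI)
    show "\<kappa> A \<in> carrier G" if "A \<in> carrier (presented_group S R)" for A
      using that by (rule presented_group_cases) (use h \<kappa> in auto)
    show "\<kappa> (A \<otimes>\<^bsub>presented_group S R\<^esub> B) = \<kappa> A \<otimes>\<^bsub>G\<^esub> \<kappa> B"
      if A: "A \<in> carrier (presented_group S R)" and B: "B \<in> carrier (presented_group S R)" for A B
      by (rule presented_group_cases[OF A], rule presented_group_cases[OF B])
        (use h \<kappa> in \<open>simp add: presented_group_mult word_eval_append\<close>)
  qed
  moreover have "\<kappa> (pres_gen S R x) = h x" if "x \<in> S" for x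
    using that h \<kappa>[of "[(x, True)]"] by (force simp: pres_gen_def)
  ultimately show thesis by (rule that)
qed

section \<open>The centre of a free group\<close>

fun cancel_cons :: "'a \<times> bool \<Rightarrow> 'a word \<Rightarrow> 'a word" where
  "cancel_cons a [] = [a]"
| "cancel_cons a (b # w) = (if b = apsnd Not a then w else a # b # w)"

definition reduce :: "'a word \<Rightarrow> 'a word" where
  "reduce w = foldr cancel_cons w []"

abbreviation reduced :: "'a word \<Rightarrow> bool" where
  "reduced \<equiv> successively (\<lambda>a b. b \<noteq> apsnd Not a)"

lemma apsnd_Not_Not [simp]: "apsnd Not (apsnd Not a) = a"
  by (cases a) simp

lemma reduced_cancel_cons: "reduced w \<Longrightarrow> reduced (cancel_cons a w)"
  by (cases w) (auto simp: successively_Cons)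

lemma reduced_foldr: "reduced v \<Longrightarrow> reduced (foldr cancel_cons w v)"
  by (induction w) (auto intro: reduced_cancel_cons)

lemma reduced_reduce: "reduced (reduce w)"
  by (simp add: reduce_def reduced_foldr)

text \<open>Makes each letter act as a permutation of the reduced words. Reducedness is essential:
  if \<open>w\<close> starts with \<open>a\<close>, the inner step removes that letter and the outer
  one must restore it, which fails when the next letter is the inverse of \<open>a\<close>.\<close>

lemma cancel_cons_inverse: "reduced w \<Longrightarrow> cancel_cons a (cancel_cons (apsnd Not a) w) = w"
  by (cases w; cases "tl w") auto

lemma reduce_reduced: "reduced w \<Longrightarrow> reduce w = w"
proof (induction w)
  case (Cons a w)
  then show ?case by (cases w) (simp_all add: reduce_def)
qed (simp add: reduce_def)

text \<open>Equal elements of the free group have the same reduced word, because a cancelling pair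
  acts trivially; the relation case is vacuous over the empty set.\<close>

lemma reduce_pres_rel: "(u, v) \<in> pres_rel S {} \<Longrightarrow> reduce u = reduce v"
proof (induction rule: pres_rel.induct)
  case (cancel u v x b)
  then show ?case
    using cancel_cons_inverse[OF reduced_reduce[of v], of "(x, b)"] by (simp add: reduce_def)
qed simp_all

lemma pres_rel_reduce: "w \<in> words S \<Longrightarrow> (w, reduce w) \<in> pres_rel S R"
proof (induction w)
  case Nil
  then show ?case by (simp add: reduce_def pres_rel.refl)
next
  case (Cons a w)
  have IH: "(w, reduce w) \<in> pres_rel S R" and a: "[a] \<in> words S"
    using Cons by auto
  then have red: "reduce w \<in> words S" using pres_rel_words by fast
  have "(a # reduce w, cancel_cons a (reduce w)) \<in> pres_rel S R"
  proof (cases "reduce w")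
    case Nil
    then show ?thesis using a by (simp add: pres_rel.refl)
  next
    case (Cons b v)
    then show ?thesis
      using red a pres_rel.cancel[of "[]" S v "fst a" "snd a" R]
      by (cases a) (auto intro: pres_rel.refl)
  qed
  moreover have "(a # w, a # reduce w) \<in> pres_rel S R"
    using pres_rel_context[OF IH a, of "[]"] by simp
  ultimately show ?case by (auto simp: reduce_def intro: pres_rel.trans)
qed

text \<open>If a nonempty reduced word w commutes with a generator y that differs from its first
  generator, then y w is reduced as it stands, while w y either is reduced with another first letter
  or collapses to something shorter.\<close>

lemma free_group_center_trivial:
  assumes "card X \<noteq> 1" and c: "c \<in> carrier (free_group X)"
    and central: "\<And>x. x \<in> X \<Longrightarrow>
      c \<otimes>\<^bsub>free_group X\<^esub> free_gen X x = free_gen X x \<otimes>\<^bsub>free_group X\<^esub> c"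
  shows "c = \<one>\<^bsub>free_group X\<^esub>"
proof -
  obtain v where v: "v \<in> words X" "c = pres_rel X {} `` {v}"
    using c by (rule presented_group_cases)
  define w where "w = reduce v"
  have vw: "(v, w) \<in> pres_rel X {}"
    using pres_rel_reduce[OF v(1)] by (simp add: w_def)
  have w: "w \<in> words X" "reduced w" "c = pres_rel X {} `` {w}"
    using pres_rel_words[OF vw] equiv_class_eq[OF equiv_pres_rel vw] v
    by (simp_all add: w_def reduced_reduce)
  have "w = []"
  proof (rule ccontr)
    assume "w \<noteq> []"
    then obtain a b w' where w': "w = (a, b) # w'" by (cases w) auto
    then have "a \<in> X" using w by simp
    \<comment> \<open>X contains \<open>a\<close>, so it is nonempty, and by assumption it is not a
      singleton.\<close>
    then obtain y where y: "y \<in> X" "y \<noteq> a"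
      using assms(1) by (metis is_singletonI' is_singleton_altdef empty_iff)
    have "pres_rel X {} `` {w @ [(y, True)]} = pres_rel X {} `` {[(y, True)] @ w}"
      using central[OF y(1)] y w by (simp add: pres_gen_def presented_group_mult)
    then have "(w @ [(y, True)], (y, True) # w) \<in> pres_rel X {}"
      using eq_equiv_class_iff[OF equiv_pres_rel, of "w @ [(y, True)]" X "(y, True) # w" "{}"] y w
      by simp
    then have "reduce (w @ [(y, True)]) = reduce ((y, True) # w)"
      by (rule reduce_pres_rel)
    also have "\<dots> = (y, True) # w"
      by (rule reduce_reduced) (use y w w' in auto)
    finally have eq: "reduce (w @ [(y, True)]) = (y, True) # w" .
    show False
    \<comment> \<open>The only possible cancellation in w y is at its end. If it happens, the result
      is two letters shorter than y w; otherwise the first letters \<open>a\<close> and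
      \<open>y\<close> clash.\<close>
    proof (cases "last w = (y, False)")
      case True
      define u where "u = butlast w"
      have u: "w = u @ [(y, False)]"
        using True \<open>w \<noteq> []\<close> by (metis append_butlast_last_id u_def)
      then have "reduced u" using w(2) by (simp add: successively_append_iff)
      then have "reduce (w @ [(y, True)]) = u"
        using reduce_reduced[of u] by (simp add: u reduce_def)
      then show False using eq u by (metis length_append length_Cons not_add_less1 lessI less_SucI)
    next
      case False
      then have "reduced (w @ [(y, True)])"
        using w(2) by (cases "last w") (auto simp: successively_append_iff)
      then show False using eq y w' reduce_reduced by fastforce
    qed
  qed
  then show ?thesis using w by (simp add: presented_group_one)
qed

section \<open>Block monomial matrices\<close>

lemma GL_mult [simp]: "A \<otimes>\<^bsub>GL m\<^esub> B = A * B"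
  by (simp add: GL_def units_of_mult ring_mat_simps)

lemma GL_one [simp]: "\<one>\<^bsub>GL m\<^esub> = 1\<^sub>m m"
  by (simp add: GL_def units_of_one ring_mat_simps)

lemma group_GL: "group (GL m)"
  unfolding GL_def by (rule monoid.units_group) (rule ring.is_monoid[OF ring_mat])

lemma GL_carrier_mat [dest]: "A \<in> carrier (GL m) \<Longrightarrow> A \<in> carrier_mat m m"
  by (simp add: GL_def units_of_carrier Units_def ring_mat_simps)

lemma GL_memI:
  "A \<in> carrier_mat m m \<Longrightarrow> B \<in> carrier_mat m m \<Longrightarrow> A * B = 1\<^sub>m m \<Longrightarrow> B * A = 1\<^sub>m m \<Longrightarrow>
    A \<in> carrier (GL m)"
  by (auto simp: GL_def units_of_carrier Units_def ring_mat_simps)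

lemma GL_inv_mult:
  assumes "A \<in> carrier (GL m)"
  shows "A * inv\<^bsub>GL m\<^esub> A = 1\<^sub>m m" "inv\<^bsub>GL m\<^esub> A * A = 1\<^sub>m m"
  using group.r_inv[OF group_GL assms] group.l_inv[OF group_GL assms] by simp_all

text \<open>Lets the position of an invertible block be read off from a block matrix. For m = 0 the
  zero matrix is the identity, hence the positivity.\<close>

lemma GL_nonzero:
  assumes "m > 0" "A \<in> carrier (GL m)"
  shows "A \<noteq> 0\<^sub>m m m"
proof
  assume "A = 0\<^sub>m m m"
  moreover have "inv\<^bsub>GL m\<^esub> A \<in> carrier_mat m m"
    using group.inv_closed[OF group_GL assms(2)] by auto
  ultimately have "(0\<^sub>m m m :: 'a mat) = 1\<^sub>m m"
    using GL_inv_mult(1)[OF assms(2)] by simp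
  then have "(0\<^sub>m m m :: 'a mat) $$ (0, 0) = 1\<^sub>m m $$ (0, 0)" by simp
  then show False using assms(1) by simp
qed

lemma smult_smult_mat: "(a :: 'p::field) \<cdot>\<^sub>m (b \<cdot>\<^sub>m A) = (a * b) \<cdot>\<^sub>m A"
  by (rule eq_matI) auto

lemma one_smult_mat [simp]: "(1 :: 'p::field) \<cdot>\<^sub>m A = A"
  by (rule eq_matI) auto

lemma smult_GL:
  assumes "s \<noteq> 0" "A \<in> carrier (GL m)"
  shows "s \<cdot>\<^sub>m A \<in> carrier (GL m)"
proof (rule GL_memI[of _ _ "inverse s \<cdot>\<^sub>m inv\<^bsub>GL m\<^esub> A"])
  have A: "A \<in> carrier_mat m m" and B: "inv\<^bsub>GL m\<^esub> A \<in> carrier_mat m m"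
    using assms group.inv_closed[OF group_GL assms(2)] by auto
  then show "s \<cdot>\<^sub>m A \<in> carrier_mat m m" "inverse s \<cdot>\<^sub>m inv\<^bsub>GL m\<^esub> A \<in> carrier_mat m m"
    by auto
  show "s \<cdot>\<^sub>m A * (inverse s \<cdot>\<^sub>m inv\<^bsub>GL m\<^esub> A) = 1\<^sub>m m"
    using A B assms by (simp add: mult_smult_distrib[of _ m m _ m] mult_smult_assoc_mat[of _ m m _ m]
      GL_inv_mult smult_smult_mat)
  show "inverse s \<cdot>\<^sub>m inv\<^bsub>GL m\<^esub> A * (s \<cdot>\<^sub>m A) = 1\<^sub>m m"
    using A B assms by (simp add: mult_smult_distrib[of _ m m _ m] mult_smult_assoc_mat[of _ m m _ m]
      GL_inv_mult smult_smult_mat)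
qed

lemma smult_GL_pow:
  fixes A :: "'p::field mat"
  assumes "A \<in> carrier (GL m)"
  shows "(s \<cdot>\<^sub>m A) [^]\<^bsub>GL m\<^esub> (l::nat) = s ^ l \<cdot>\<^sub>m (A [^]\<^bsub>GL m\<^esub> l)"
proof -
  interpret G: group "GL m :: 'p mat monoid" by (rule group_GL)
  have pow: "A [^]\<^bsub>GL m\<^esub> k \<in> carrier_mat m m" for k :: nat
    using G.nat_pow_closed[OF assms] by auto
  show ?thesis
    using assms pow
    by (induction l)
      (auto simp: mult_smult_distrib[of _ m m _ m] mult_smult_assoc_mat[of _ m m _ m]
        smult_smult_mat mult.commute)
qed

section \<open>Index arithmetic of block matrices\<close>

lemma block_index_less: "i < n \<Longrightarrow> a < m \<Longrightarrow> i * m + a < m * (n::nat)"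
proof -
  assume "i < n" "a < m"
  then have "i * m + a < Suc i * m" by simp
  also have "\<dots> \<le> n * m" using \<open>i < n\<close> by (intro mult_right_mono) auto
  finally show ?thesis by (simp add: mult.commute)
qed

lemma block_mat_carrier [simp]: "block_mat n m B \<in> carrier_mat (m * n) (m * n)"
  by (simp add: block_mat_def)

lemma block_mat_index:
  assumes "i < n" "j < n" "a < m" "b < m"
  shows "block_mat n m B $$ (i * m + a, j * m + b) = B i j $$ (a, b)"
  using assms by (simp add: block_mat_def block_index_less)

lemma div_mod_less: "r < m * n \<Longrightarrow> r div m < n \<and> r mod m < (m::nat)"
  by (metis less_mult_imp_div_less mod_less_divisor mult.commute mult_is_0 not_less_zero neq0_conv)

lemma block_mat_cong:
  assumes "\<And>i j. i < n \<Longrightarrow> j < n \<Longrightarrow> B i j = C i j"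
  shows "block_mat n m B = block_mat n m C"
  using assms by (auto simp: block_mat_def div_mod_less intro!: eq_matI)

lemma block_mat_inject:
  assumes "block_mat n m B = block_mat n m C" "i < n" "j < n"
    and "B i j \<in> carrier_mat m m" "C i j \<in> carrier_mat m m"
  shows "B i j = C i j"
proof (rule eq_matI)
  show "B i j $$ (a, b) = C i j $$ (a, b)" if "a < dim_row (C i j)" "b < dim_col (C i j)" for a b
    using that assms block_mat_index[of i n j a m b B] block_mat_index[of i n j a m b C] by auto
qed (use assms in auto)

lemma sum_blocks:
  fixes F :: "nat \<Rightarrow> 'b::comm_monoid_add"
  shows "(\<Sum>q<m * n. F q) = (\<Sum>k<n. \<Sum>c<m. F (k * m + c))"
proof -
  have "(\<Sum>q<m * n. F q) = (\<Sum>k<n. sum F {k * m..<k * m + m})"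
    by (simp add: sum.nat_group mult.commute)
  also have "\<dots> = (\<Sum>k<n. \<Sum>c<m. F (k * m + c))"
    using sum.shift_bounds_nat_ivl[of F 0 "_ * m" m]
    by (simp add: add.commute atLeast0LessThan)
  finally show ?thesis .
qed

text \<open>Block monomial matrices: row \<open>i\<close> carries its only block \<open>D i\<close>
  in column \<open>p i\<close>. With \<open>p\<close> a permutation and invertible blocks, these
  form the wreath product of GL_m with the symmetric group, which contains both the shift and the
  diagonal matrices.\<close>

definition perm_block :: "nat \<Rightarrow> nat \<Rightarrow> (nat \<Rightarrow> nat) \<Rightarrow> (nat \<Rightarrow> 'p::field mat) \<Rightarrow> 'p mat" where
  "perm_block n m p D = block_mat n m (\<lambda>i j. if j = p i then D i else 0\<^sub>m m m)"

lemma perm_block_carrier [simp]: "perm_block n m p D \<in> carrier_mat (m * n) (m * n)"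
  by (simp add: perm_block_def)

lemma perm_block_dim [simp]:
  "dim_row (perm_block n m p D) = m * n" "dim_col (perm_block n m p D) = m * n"
  by (simp_all add: perm_block_def block_mat_def)

lemma perm_block_cong:
  "(\<And>i. i < n \<Longrightarrow> p i = q i) \<Longrightarrow> (\<And>i. i < n \<Longrightarrow> D i = E i) \<Longrightarrow>
    perm_block n m p D = perm_block n m q E"
  unfolding perm_block_def by (rule block_mat_cong) simp

lemma perm_block_mult:
  assumes p: "\<And>i. i < n \<Longrightarrow> p i < n"
    and D: "\<And>i. i < n \<Longrightarrow> D i \<in> carrier_mat m m" and E: "\<And>i. i < n \<Longrightarrow> E i \<in> carrier_mat m m"
  shows "perm_block n m p D * perm_block n m q E =
    perm_block n m (\<lambda>i. q (p i)) (\<lambda>i. D i * E (p i))"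
proof (rule eq_matI)
  fix r c
  assume "r < dim_row (perm_block n m (\<lambda>i. q (p i)) (\<lambda>i. D i * E (p i)))"
    and "c < dim_col (perm_block n m (\<lambda>i. q (p i)) (\<lambda>i. D i * E (p i)))"
  then have rc: "r < m * n" "c < m * n" by (simp_all add: perm_block_def block_mat_def)
  define i a j b where "i = r div m" and "a = r mod m" and "j = c div m" and "b = c mod m"
  have ij: "i < n" "a < m" "j < n" "b < m" and r: "r = i * m + a" and c: "c = j * m + b"
    using rc by (simp_all add: i_def a_def j_def b_def div_mod_less)
  have pi: "p i < n" and Di: "D i \<in> carrier_mat m m" and Ei: "E (p i) \<in> carrier_mat m m"
    using ij p D E by auto
  have "(perm_block n m p D * perm_block n m q E) $$ (r, c) =
      (\<Sum>k<m * n. perm_block n m p D $$ (r, k) * perm_block n m q E $$ (k, c))"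
    using rc by (simp add: scalar_prod_def atLeast0LessThan)
  also have "\<dots> = (\<Sum>k<n. \<Sum>l<m. (if k = p i then D i else 0\<^sub>m m m) $$ (a, l) *
      (if j = q k then E k else 0\<^sub>m m m) $$ (l, b))"
    using ij by (simp add: sum_blocks r c perm_block_def block_mat_index)
  \<comment> \<open>Row \<open>i\<close> of the left factor vanishes outside block column
    \<open>p i\<close>, so one summand over \<open>k\<close> survives.\<close>
  also have "\<dots> = (\<Sum>k<n. if k = p i
      then \<Sum>l<m. D i $$ (a, l) * (if j = q k then E k else 0\<^sub>m m m) $$ (l, b) else 0)"
    using ij by (intro sum.cong) (auto intro!: sum.neutral)
  also have "\<dots> = (\<Sum>l<m. D i $$ (a, l) * (if j = q (p i) then E (p i) else 0\<^sub>m m m) $$ (l, b))"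
    using pi by (simp add: sum.delta)
  also have "\<dots> = (if j = q (p i) then D i * E (p i) else 0\<^sub>m m m) $$ (a, b)"
    using Di Ei ij by (auto simp: scalar_prod_def atLeast0LessThan)
  also have "\<dots> = perm_block n m (\<lambda>i. q (p i)) (\<lambda>i. D i * E (p i)) $$ (r, c)"
    using ij by (simp add: r c perm_block_def block_mat_index)
  finally show "(perm_block n m p D * perm_block n m q E) $$ (r, c) =
    perm_block n m (\<lambda>i. q (p i)) (\<lambda>i. D i * E (p i)) $$ (r, c)" .
qed (simp_all add: perm_block_def block_mat_def)

lemma perm_block_one: "perm_block n m (\<lambda>i. i) (\<lambda>i. 1\<^sub>m m) = 1\<^sub>m (m * n)"
proof (rule eq_matI)
  show "perm_block n m (\<lambda>i. i) (\<lambda>i. 1\<^sub>m m) $$ (r, c) = 1\<^sub>m (m * n) $$ (r, c)"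
    if "r < dim_row (1\<^sub>m (m * n))" "c < dim_col (1\<^sub>m (m * n))" for r c
    using that div_mod_less[of r m n] div_mod_less[of c m n]
    by (auto simp: perm_block_def block_mat_def) (metis div_mult_mod_eq)+
qed (simp_all add: perm_block_def block_mat_def)

lemma perm_block_GL:
  assumes p: "bij_betw p {..<n} {..<n}" and D: "\<And>i. i < n \<Longrightarrow> D i \<in> carrier (GL m)"
  shows "perm_block n m p D \<in> carrier (GL (m * n))"
proof -
  define q where "q = inv_into {..<n} p"
  have p_less: "p i < n" and qp: "q (p i) = i" if "i < n" for i
    using that p bij_betw_apply[OF p, of i] by (auto simp: q_def bij_betw_inv_into_left)
  have q_less: "q i < n" and pq: "p (q i) = i" if "i < n" for i
    using that p bij_betw_apply[OF bij_betw_inv_into[OF p], of i]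
    by (auto simp: q_def bij_betw_inv_into_right)
  \<comment> \<open>Row \<open>i\<close> of the inverse must undo the block of \<open>D\<close> that
    lies in column \<open>i\<close>, and that block sits in row \<open>q i\<close>.\<close>
  define E where "E i = inv\<^bsub>GL m\<^esub> D (q i)" for i
  have "E i \<in> carrier (GL m)" if "i < n" for i
    using that D q_less by (simp add: E_def group.inv_closed[OF group_GL])
  then have DE: "D i \<in> carrier_mat m m" "E i \<in> carrier_mat m m" if "i < n" for i
    using that D by auto
  show ?thesis
  proof (rule GL_memI)
    have "perm_block n m p D * perm_block n m q E = perm_block n m (\<lambda>i. i) (\<lambda>i. 1\<^sub>m m)"
      using p_less DE D qp
      by (subst perm_block_mult) (auto simp: E_def GL_inv_mult intro!: perm_block_cong)
    then show "perm_block n m p D * perm_block n m q E = 1\<^sub>m (m * n)"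
      by (simp add: perm_block_one)
    have "perm_block n m q E * perm_block n m p D = perm_block n m (\<lambda>i. i) (\<lambda>i. 1\<^sub>m m)"
      using q_less DE D pq
      by (subst perm_block_mult) (auto simp: E_def GL_inv_mult intro!: perm_block_cong)
    then show "perm_block n m q E * perm_block n m p D = 1\<^sub>m (m * n)"
      by (simp add: perm_block_one)
  qed simp_all
qed

text \<open>At block position (i, p i) the left side is \<open>D i\<close>, which is nonzero, and
  the right side is \<open>E i\<close> or zero. One row is enough, so only row \<open>i\<close> is
  constrained.\<close>

lemma perm_block_inject:
  assumes eq: "perm_block n m p D = perm_block n m q E" and "m > 0" "i < n" "p i < n"
    and D: "D i \<in> carrier (GL m)" and E: "E i \<in> carrier (GL m)"
  shows "p i = q i \<and> D i = E i"
proof -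
  have "D i = (if p i = q i then E i else 0\<^sub>m m m)"
    using block_mat_inject[OF eq[unfolded perm_block_def] \<open>i < n\<close> \<open>p i < n\<close>]
      GL_carrier_mat[OF D] GL_carrier_mat[OF E] by auto
  then show ?thesis
    using GL_nonzero[OF \<open>m > 0\<close> D] by metis
qed

lemma block_diag_mat_eq_perm_block: "block_diag_mat n m D = perm_block n m (\<lambda>i. i) D"
  unfolding block_diag_mat_def perm_block_def by (rule block_mat_cong) simp

text \<open>The modulus sends the last row back to column 0. There \<open>j = i + 1\<close> is out
  of range, so the corner block is reached in the definition, also for n = 1.\<close>

lemma block_shift_mat_eq_perm_block:
  "block_shift_mat n m s A =
    perm_block n m (\<lambda>i. Suc i mod n) (\<lambda>i. if Suc i = n then s \<cdot>\<^sub>m A else 1\<^sub>m m)"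
  unfolding block_shift_mat_def perm_block_def
  by (rule block_mat_cong) (auto simp: mod_Suc)

lemma bij_betw_Suc_mod: "bij_betw (\<lambda>i. Suc i mod n) {..<n} {..<n}"
proof -
  have "inj_on (\<lambda>i. Suc i mod n) {..<n}"
    by (auto simp: inj_on_def mod_Suc split: if_splits)
  moreover have "(\<lambda>i. Suc i mod n) ` {..<n} \<subseteq> {..<n}" by auto
  ultimately show ?thesis
    by (simp add: bij_betw_def endo_inj_surj)
qed

text \<open>Starting at row i < n, k cyclic steps pass the corner (i + k) div n times, and each
  passage contributes one factor \<open>U\<close>.\<close>

lemma perm_block_shift_pow:
  fixes U :: "'p::field mat"
  assumes U: "U \<in> carrier (GL m)" and n: "n > 0"
  shows "perm_block n m (\<lambda>i. Suc i mod n) (\<lambda>i. if Suc i = n then U else 1\<^sub>m m)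
      [^]\<^bsub>GL (m * n)\<^esub> k =
    perm_block n m (\<lambda>i. (i + k) mod n) (\<lambda>i. U [^]\<^bsub>GL m\<^esub> ((i + k) div n))"
proof (induction k)
  case 0
  show ?case
    by (simp flip: perm_block_one) (rule perm_block_cong, simp_all)
next
  case (Suc k)
  interpret G: group "GL m :: 'p mat monoid" by (rule group_GL)
  have pow: "U [^]\<^bsub>GL m\<^esub> l \<in> carrier_mat m m" for l :: nat
    using G.nat_pow_closed[OF U] by auto
  have "perm_block n m (\<lambda>i. (i + k) mod n) (\<lambda>i. U [^]\<^bsub>GL m\<^esub> ((i + k) div n)) *
      perm_block n m (\<lambda>i. Suc i mod n) (\<lambda>i. if Suc i = n then U else 1\<^sub>m m) =
    perm_block n m (\<lambda>i. Suc ((i + k) mod n) mod n)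
      (\<lambda>i. U [^]\<^bsub>GL m\<^esub> ((i + k) div n) * (if Suc ((i + k) mod n) = n then U else 1\<^sub>m m))"
    using n U pow by (intro perm_block_mult) auto
  \<comment> \<open>The quotient grows by one exactly when the next step wraps around to 0.\<close>
  also have "\<dots> = perm_block n m (\<lambda>i. (i + Suc k) mod n) (\<lambda>i. U [^]\<^bsub>GL m\<^esub> ((i + Suc k) div n))"
    using n pow by (intro perm_block_cong) (auto simp: mod_Suc_eq div_Suc mod_Suc right_mult_one_mat[OF pow])
  finally show ?case using Suc by simp
qed

section \<open>Normal forms in the mapping torus\<close>

lemma AutoGroup_hom: "\<psi> \<in> carrier (AutoGroup G) \<Longrightarrow> \<psi> \<in> hom G G"
  by (simp add: AutoGroup_def auto_def)

lemma AutoGroup_apply_closed: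
  "\<psi> \<in> carrier (AutoGroup G) \<Longrightarrow> g \<in> carrier G \<Longrightarrow> \<psi> g \<in> carrier G"
  by (rule hom_in_carrier[OF AutoGroup_hom])

text \<open>The product in \<open>AutoGroup\<close> is composition restricted to the carrier, so it
  can be unfolded only at an element of the carrier.\<close>

lemma AutoGroup_apply_mult:
  assumes "\<psi> \<in> carrier (AutoGroup G)" "\<chi> \<in> carrier (AutoGroup G)" "g \<in> carrier G"
  shows "(\<psi> \<otimes>\<^bsub>AutoGroup G\<^esub> \<chi>) g = \<psi> (\<chi> g)"
  using assms by (simp add: AutoGroup_def BijGroup_def auto_def compose_def)

lemma AutoGroup_apply_one: "g \<in> carrier G \<Longrightarrow> \<one>\<^bsub>AutoGroup G\<^esub> g = g"
  by (simp add: AutoGroup_def BijGroup_def)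

lemma (in group) conj_hom:
  assumes "f \<in> carrier G"
  shows "(\<lambda>g. inv f \<otimes> g \<otimes> f) \<in> hom G G"
proof (rule homI)
  show "inv f \<otimes> (x \<otimes> y) \<otimes> f = inv f \<otimes> x \<otimes> f \<otimes> (inv f \<otimes> y \<otimes> f)"
    if xy: "x \<in> carrier G" "y \<in> carrier G" for x y
  proof -
    have "f \<otimes> (inv f \<otimes> (y \<otimes> f)) = y \<otimes> f"
      using xy assms by (simp flip: m_assoc)
    then show ?thesis using xy assms by (simp add: m_assoc)
  qed
qed (use assms in auto)

text \<open>Serves the relations of the extension, which range over all words in the class \<phi>(x)
  and not over a chosen one.\<close>

lemma pres_class_of_member:
  assumes "A \<in> carrier (presented_group S R)" "w \<in> A"
  shows "w \<in> words S" "A = pres_rel S R `` {w}"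
proof -
  obtain v where v: "v \<in> words S" "A = pres_rel S R `` {v}"
    using assms(1) by (rule presented_group_cases)
  then have "(v, w) \<in> pres_rel S R" using assms(2) by simp
  then show "w \<in> words S" "A = pres_rel S R `` {w}"
    using pres_rel_words equiv_class_eq[OF equiv_pres_rel] v by fastforce+
qed

text \<open>Powers of t can be pushed to the right: t^-1 g = \<phi>(g) t^-1 and t g = \<phi>^-1(g)
  t. Only existence of g and k is claimed here; the matrices determine them later.\<close>

lemma hnn_normal_form:
  assumes aut: "\<phi> \<in> carrier (AutoGroup (free_group X))"
  obtains \<iota> where "\<iota> \<in> hom (free_group X) (hnn_group X \<phi>)"
    "\<And>x. x \<in> X \<Longrightarrow> \<iota> (free_gen X x) = hnn_gen X \<phi> (Some x)"
    "\<And>h. h \<in> carrier (hnn_group X \<phi>) \<Longrightarrow> \<exists>g \<in> carrier (free_group X). \<exists>k::int.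
      h = \<iota> g \<otimes>\<^bsub>hnn_group X \<phi>\<^esub> hnn_gen X \<phi> None [^]\<^bsub>hnn_group X \<phi>\<^esub> k"
proof -
  let ?F = "free_group X" and ?H = "hnn_group X \<phi>"
  let ?S = "hnn_gens X" and ?R = "hnn_rels X \<phi>"
  interpret F: group ?F by (rule group_presented_group)
  interpret H: group ?H by (rule group_presented_group)
  interpret A: group "AutoGroup ?F" by (rule F.AutoGroup)
  define t where "t = hnn_gen X \<phi> None"
  have t: "t \<in> carrier ?H" by (simp add: t_def hnn_gens_def)
  have gen: "hnn_gen X \<phi> \<circ> Some \<in> X \<rightarrow> carrier ?H" by (simp add: hnn_gens_def)
  obtain \<iota> where \<iota>: "\<iota> \<in> hom ?F ?H" "\<And>x. x \<in> X \<Longrightarrow> \<iota> (free_gen X x) = hnn_gen X \<phi> (Some x)"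
    using presented_group_lift[OF H.group_axioms gen, of "{}"] by auto
  interpret \<iota>: group_hom ?F ?H \<iota>
    using \<iota>(1) by (simp add: group_hom_def group_hom_axioms_def F.group_axioms H.group_axioms)
  \<comment> \<open>Both sides are homomorphisms in \<open>g\<close>, so it is enough to compare
    them on X, where equality is the defining relation.\<close>
  have conj: "inv\<^bsub>?H\<^esub> t \<otimes>\<^bsub>?H\<^esub> \<iota> g \<otimes>\<^bsub>?H\<^esub> t = \<iota> (\<phi> g)" if "g \<in> carrier ?F" for g
  proof (rule presented_group_hom_eqI[OF H.group_axioms _ _ _ that])
    show "(\<lambda>g. inv\<^bsub>?H\<^esub> t \<otimes>\<^bsub>?H\<^esub> \<iota> g \<otimes>\<^bsub>?H\<^esub> t) \<in> hom ?F ?H"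
      using hom_compose[OF \<iota>(1) H.conj_hom[OF t]] by (simp add: comp_def)
    show "(\<lambda>g. \<iota> (\<phi> g)) \<in> hom ?F ?H"
      using hom_compose[OF AutoGroup_hom[OF aut] \<iota>(1)] by (simp add: comp_def)
  next
    fix x assume x: "x \<in> X"
    then have "\<phi> (free_gen X x) \<in> carrier ?F"
      using AutoGroup_apply_closed[OF aut] by simp
    then obtain w where w: "w \<in> words X" "\<phi> (free_gen X x) = pres_rel X {} `` {w}"
      by (rule presented_group_cases)
    have w_in: "w \<in> \<phi> (free_gen X x)"
      using equiv_class_self[OF equiv_pres_rel w(1)] w(2) by simp
    have Sw: "map (apfst Some) w \<in> words ?S"
      using w(1) by (induction w) (auto simp: hnn_gens_def)
    have "\<iota> (\<phi> (free_gen X x)) = word_eval ?H (\<iota> \<circ> free_gen X) w"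
      using w by (simp add: hom_pres_class[OF H.group_axioms \<iota>(1)])
    also have "\<dots> = word_eval ?H (hnn_gen X \<phi> \<circ> Some) w"
      using w(1) \<iota>(2) by (intro word_eval_cong) auto
    also have "\<dots> = pres_rel ?S ?R `` {map (apfst Some) w}"
      using word_eval_pres_gen[OF Sw] by (simp add: word_eval_map_apfst)
    also have "\<dots> = pres_rel ?S ?R `` {[(None, False), (Some x, True), (None, True)]}"
    proof (rule equiv_class_eq[OF equiv_pres_rel, symmetric])
      have "([(None, False), (Some x, True), (None, True)], map (apfst Some) w) \<in> ?R"
        using x w_in by (auto simp: hnn_rels_def)
      then show "([(None, False), (Some x, True), (None, True)], map (apfst Some) w)
          \<in> pres_rel ?S ?R"
        using pres_rel.relation[of "[]" ?S "[]" _ "map (apfst Some) w" ?R] x Sw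
        by (simp add: hnn_gens_def)
    qed
    also have "\<dots> = inv\<^bsub>?H\<^esub> t \<otimes>\<^bsub>?H\<^esub> \<iota> (free_gen X x) \<otimes>\<^bsub>?H\<^esub> t"
    proof -
      have "None \<in> ?S" "Some x \<in> ?S" using x by (simp_all add: hnn_gens_def)
      then show ?thesis
        using x \<iota>(2) word_eval_pres_gen[of "[(None, False), (Some x, True), (None, True)]" ?S ?R]
        by (simp add: t_def H.m_assoc)
    qed
    finally show "inv\<^bsub>?H\<^esub> t \<otimes>\<^bsub>?H\<^esub> \<iota> (free_gen X x) \<otimes>\<^bsub>?H\<^esub> t = \<iota> (\<phi> (free_gen X x))" ..
  qed
  have t_inv_\<iota>: "inv\<^bsub>?H\<^esub> t \<otimes>\<^bsub>?H\<^esub> \<iota> g = \<iota> (\<phi> g) \<otimes>\<^bsub>?H\<^esub> inv\<^bsub>?H\<^esub> t" if "g \<in> carrier ?F" for g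
    using conj[OF that, symmetric] t that by (simp add: H.m_assoc)
  have t_\<iota>: "t \<otimes>\<^bsub>?H\<^esub> \<iota> g = \<iota> ((inv\<^bsub>AutoGroup ?F\<^esub> \<phi>) g) \<otimes>\<^bsub>?H\<^esub> t"
    and inv_closed: "(inv\<^bsub>AutoGroup ?F\<^esub> \<phi>) g \<in> carrier ?F" if g: "g \<in> carrier ?F" for g
  proof -
    have inv: "inv\<^bsub>AutoGroup ?F\<^esub> \<phi> \<in> carrier (AutoGroup ?F)" using aut by simp
    show closed: "(inv\<^bsub>AutoGroup ?F\<^esub> \<phi>) g \<in> carrier ?F"
      using AutoGroup_apply_closed[OF inv g] .
    \<comment> \<open>Invertibility of \<phi> enters here: the rule for t is the conjugation rule
      taken at \<phi>^-1(g).\<close>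
    have "\<phi> ((inv\<^bsub>AutoGroup ?F\<^esub> \<phi>) g) = g"
      using AutoGroup_apply_mult[OF aut inv g] AutoGroup_apply_one[OF g] A.r_inv[OF aut] by simp
    then have "\<iota> g = inv\<^bsub>?H\<^esub> t \<otimes>\<^bsub>?H\<^esub> (\<iota> ((inv\<^bsub>AutoGroup ?F\<^esub> \<phi>) g) \<otimes>\<^bsub>?H\<^esub> t)"
      using conj[OF closed] t closed by (simp add: H.m_assoc)
    then show "t \<otimes>\<^bsub>?H\<^esub> \<iota> g = \<iota> ((inv\<^bsub>AutoGroup ?F\<^esub> \<phi>) g) \<otimes>\<^bsub>?H\<^esub> t"
      using t closed by (simp flip: H.m_assoc)
  qed
  \<comment> \<open>Letters are prepended: a letter from X is absorbed into \<open>g\<close>, while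
    t or t^-1 passes \<open>g\<close> and shifts \<open>k\<close>.\<close>
  have "\<exists>g \<in> carrier ?F. \<exists>k::int. word_eval ?H (hnn_gen X \<phi>) w = \<iota> g \<otimes>\<^bsub>?H\<^esub> t [^]\<^bsub>?H\<^esub> k"
    if "w \<in> words ?S" for w
    using that
  proof (induction w)
    case Nil
    have "\<one>\<^bsub>?H\<^esub> = \<iota> \<one>\<^bsub>?F\<^esub> \<otimes>\<^bsub>?H\<^esub> t [^]\<^bsub>?H\<^esub> (0::int)" by simp
    then show ?case using F.one_closed by (metis word_eval_simps(1))
  next
    case (Cons a w)
    then obtain g and k :: int where g: "g \<in> carrier ?F"
      and gk: "word_eval ?H (hnn_gen X \<phi>) w = \<iota> g \<otimes>\<^bsub>?H\<^esub> t [^]\<^bsub>?H\<^esub> k" by auto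
    obtain y b where a: "a = (y, b)" by (cases a)
    have tk: "t [^]\<^bsub>?H\<^esub> k \<in> carrier ?H" using t by simp
    show ?case
    proof (cases y)
      case None
      show ?thesis
      proof (cases b)
        case True
        have "word_eval ?H (hnn_gen X \<phi>) (a # w) = t \<otimes>\<^bsub>?H\<^esub> \<iota> g \<otimes>\<^bsub>?H\<^esub> t [^]\<^bsub>?H\<^esub> k"
          using a None True gk g t tk by (simp add: t_def[symmetric] H.m_assoc)
        also have "\<dots> = \<iota> ((inv\<^bsub>AutoGroup ?F\<^esub> \<phi>) g) \<otimes>\<^bsub>?H\<^esub> t [^]\<^bsub>?H\<^esub> (1 + k)"
          using t_\<iota>[OF g] inv_closed[OF g] t tk by (simp add: H.m_assoc H.int_pow_mult)
        finally show ?thesis using inv_closed[OF g] by blast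
      next
        case False
        have \<phi>g: "\<phi> g \<in> carrier ?F" using AutoGroup_apply_closed[OF aut g] .
        have "word_eval ?H (hnn_gen X \<phi>) (a # w) = inv\<^bsub>?H\<^esub> t \<otimes>\<^bsub>?H\<^esub> \<iota> g \<otimes>\<^bsub>?H\<^esub> t [^]\<^bsub>?H\<^esub> k"
          using a None False gk g t tk by (simp add: t_def[symmetric] H.m_assoc)
        also have "\<dots> = \<iota> (\<phi> g) \<otimes>\<^bsub>?H\<^esub> t [^]\<^bsub>?H\<^esub> (- 1 + k)"
          using t_inv_\<iota>[OF g] \<phi>g t tk by (simp only: H.int_pow_mult)
            (simp add: H.m_assoc H.int_pow_neg)
        finally show ?thesis using \<phi>g by blast
      qed
    next
      case (Some x)
      then have x: "x \<in> X" using Cons.prems a by (auto simp: hnn_gens_def)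
      define e where "e = (if b then free_gen X x else inv\<^bsub>?F\<^esub> free_gen X x)"
      have e: "e \<in> carrier ?F" using x by (simp add: e_def)
      have "word_eval ?H (hnn_gen X \<phi>) (a # w) = \<iota> e \<otimes>\<^bsub>?H\<^esub> (\<iota> g \<otimes>\<^bsub>?H\<^esub> t [^]\<^bsub>?H\<^esub> k)"
        using a Some gk x by (simp add: e_def \<iota>(2))
      also have "\<dots> = \<iota> (e \<otimes>\<^bsub>?F\<^esub> g) \<otimes>\<^bsub>?H\<^esub> t [^]\<^bsub>?H\<^esub> k"
        using e g tk by (simp add: H.m_assoc)
      finally show ?thesis using e g by blast
    qed
  qed
  then have "\<exists>g \<in> carrier ?F. \<exists>k::int. h = \<iota> g \<otimes>\<^bsub>?H\<^esub> hnn_gen X \<phi> None [^]\<^bsub>?H\<^esub> k"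
    if "h \<in> carrier ?H" for h
    using that by (auto simp: word_eval_pres_gen t_def elim!: presented_group_cases)
  then show thesis using \<iota> that by blast
qed

section \<open>The representation\<close>

locale virtually_inner_rep =
  fixes X :: "'a set"
    and \<phi> :: "'a word set \<Rightarrow> 'a word set"
    and f :: "'a word set"
    and \<sigma> :: "'a word set \<Rightarrow> 'p::field mat"
    and s :: 'p
    and m n :: nat
  assumes m_pos: "m > 0"
    and n_pos: "n > 0"
    and aut: "\<phi> \<in> carrier (AutoGroup (free_group X))"
    and f_carrier: "f \<in> carrier (free_group X)"
    and f_conj: "\<forall>x\<in>X. (\<phi> [^]\<^bsub>AutoGroup (free_group X)\<^esub> n) (free_gen X x) =
        inv\<^bsub>free_group X\<^esub> f \<otimes>\<^bsub>free_group X\<^esub> free_gen X x \<otimes>\<^bsub>free_group X\<^esub> f"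
    and faithful: "\<sigma> \<in> mon (free_group X) (GL m)"
    and s_unit: "s \<noteq> 0"
    and s_order: "\<forall>k::nat. k > 0 \<longrightarrow> s ^ k \<noteq> 1"
begin

section \<open>The matrices of the generators and the relations between them\<close>

abbreviation "F \<equiv> free_group X"
abbreviation "H \<equiv> hnn_group X \<phi>"

definition D :: "'a word set \<Rightarrow> nat \<Rightarrow> 'p mat" where
  "D g i = \<sigma> ((\<phi> [^]\<^bsub>AutoGroup F\<^esub> (- int i)) g)"

text \<open>Given by its formula on all of F(X) and not only on X, so that it can be evaluated at
  \<phi>(x) once it is known to be a homomorphism.\<close>

definition \<delta> :: "'a word set \<Rightarrow> 'p mat" where
  "\<delta> g = block_diag_mat n m (D g)"

text \<open>The factor collected in each full turn of the shift: the n-th power of \<open>T\<close>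
  has \<open>U\<close> in every diagonal block.\<close>

definition U :: "'p mat" where "U = s \<cdot>\<^sub>m \<sigma> f"

definition T :: "'p mat" where "T = block_shift_mat n m s (\<sigma> f)"

sublocale F: group F by (rule group_presented_group)

sublocale H: group H by (rule group_presented_group)

sublocale A: group "AutoGroup F" by (rule F.AutoGroup)

sublocale GL: group "GL k :: 'p mat monoid" for k by (rule group_GL)

lemma \<sigma>_hom: "\<sigma> \<in> hom F (GL m)" and \<sigma>_inj: "inj_on \<sigma> (carrier F)"
  using faithful by (auto simp: mon_def)

sublocale \<sigma>: group_hom F "GL m" \<sigma>
  using \<sigma>_hom by (simp add: group_hom_def group_hom_axioms_def F.group_axioms GL.group_axioms)

lemma \<phi>_pow: "\<phi> [^]\<^bsub>AutoGroup F\<^esub> (k::int) \<in> carrier (AutoGroup F)"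
  using aut by simp

lemma D_hom: "(\<lambda>g. D g i) \<in> hom F (GL m)"
  using hom_compose[OF AutoGroup_hom[OF \<phi>_pow] \<sigma>_hom] by (simp add: D_def comp_def)

lemma D_GL: "g \<in> carrier F \<Longrightarrow> D g i \<in> carrier (GL m)"
  using hom_in_carrier[OF D_hom] .

lemma D_0: "g \<in> carrier F \<Longrightarrow> D g 0 = \<sigma> g"
  by (simp add: D_def AutoGroup_apply_one)

lemma U_GL: "U \<in> carrier (GL m)"
  unfolding U_def by (rule smult_GL[OF s_unit]) (simp add: f_carrier)

lemma \<delta>_eq: "\<delta> g = perm_block n m (\<lambda>i. i) (D g)"
  by (simp add: \<delta>_def block_diag_mat_eq_perm_block)

lemma T_eq: "T = perm_block n m (\<lambda>i. Suc i mod n) (\<lambda>i. if Suc i = n then U else 1\<^sub>m m)"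
  unfolding T_def U_def by (rule block_shift_mat_eq_perm_block)

lemma T_GL: "T \<in> carrier (GL (m * n))"
  unfolding T_eq
  by (rule perm_block_GL[OF bij_betw_Suc_mod]) (use U_GL GL.one_closed[of m] in simp)

lemma \<delta>_hom: "\<delta> \<in> hom F (GL (m * n))"
proof (rule homI)
  show "\<delta> g \<in> carrier (GL (m * n))" if "g \<in> carrier F" for g
    unfolding \<delta>_eq using that D_GL by (intro perm_block_GL) (auto simp: bij_betw_def)
  show "\<delta> (g \<otimes>\<^bsub>F\<^esub> h) = \<delta> g \<otimes>\<^bsub>GL (m * n)\<^esub> \<delta> h"
    if g: "g \<in> carrier F" and h: "h \<in> carrier F" for g h
    using g h hom_mult[OF D_hom g h]
    by (auto simp: \<delta>_eq perm_block_mult GL_carrier_mat[OF D_GL] intro!: perm_block_cong)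
qed

lemma \<phi>_pow_n:
  assumes "g \<in> carrier F"
  shows "(\<phi> [^]\<^bsub>AutoGroup F\<^esub> n) g = inv\<^bsub>F\<^esub> f \<otimes>\<^bsub>F\<^esub> g \<otimes>\<^bsub>F\<^esub> f"
proof (rule presented_group_hom_eqI[OF F.group_axioms _ F.conj_hom[OF f_carrier] _ assms])
  show "\<phi> [^]\<^bsub>AutoGroup F\<^esub> n \<in> hom F F"
    using aut by (intro AutoGroup_hom A.nat_pow_closed)
qed (use f_conj in blast)

text \<open>The defining relation in inverse-free form. Rows before the last compare \<phi>^-i(g)
  with \<phi>^-(i+1) applied to \<phi>(g); the last row is where conjugation by f is used, and the
  scalar s passes through every block.\<close>

lemma \<delta>_mult_T:
  assumes g: "g \<in> carrier F"
  shows "\<delta> g * T = T * \<delta> (\<phi> g)"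
proof -
  have \<phi>g: "\<phi> g \<in> carrier F" using AutoGroup_apply_closed[OF aut g] .
  have step: "D (\<phi> g) (Suc i) = D g i" for i
  proof -
    have "\<phi> [^]\<^bsub>AutoGroup F\<^esub> (- int (Suc i)) \<otimes>\<^bsub>AutoGroup F\<^esub> \<phi> = \<phi> [^]\<^bsub>AutoGroup F\<^esub> (- int i)"
      using A.int_pow_mult[OF aut, of "- int (Suc i)" 1] aut by simp
    then show ?thesis
      using AutoGroup_apply_mult[OF \<phi>_pow aut g, of "- int (Suc i)"] by (simp add: D_def)
  qed
  have wrap: "D g i * U = U * \<sigma> (\<phi> g)" if i: "Suc i = n" for i
  proof -
    define y where "y = (\<phi> [^]\<^bsub>AutoGroup F\<^esub> (- int i)) g"
    have y: "y \<in> carrier F"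
      unfolding y_def by (rule AutoGroup_apply_closed[OF \<phi>_pow g])
    \<comment> \<open>Here i = n - 1, so the exponents n and -i add up to 1.\<close>
    have "\<phi> [^]\<^bsub>AutoGroup F\<^esub> n \<otimes>\<^bsub>AutoGroup F\<^esub> \<phi> [^]\<^bsub>AutoGroup F\<^esub> (- int i) = \<phi>"
      using A.int_pow_mult[OF aut, of "int n" "- int i"] i aut by (auto simp: int_pow_int)
    then have "\<phi> g = inv\<^bsub>F\<^esub> f \<otimes>\<^bsub>F\<^esub> y \<otimes>\<^bsub>F\<^esub> f"
      using AutoGroup_apply_mult[OF A.nat_pow_closed[OF aut, of n] \<phi>_pow g, of "- int i"]
        \<phi>_pow_n[OF y] by (simp add: y_def)
    then have "y \<otimes>\<^bsub>F\<^esub> f = f \<otimes>\<^bsub>F\<^esub> \<phi> g"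
      using y f_carrier by (simp add: F.m_assoc) (simp flip: F.m_assoc)
    then have "\<sigma> y * \<sigma> f = \<sigma> f * \<sigma> (\<phi> g)"
      using \<sigma>.hom_mult y f_carrier \<phi>g by (metis GL_mult)
    then show ?thesis
      using y f_carrier \<phi>g GL_carrier_mat[OF \<sigma>.hom_closed]
      by (simp add: D_def U_def flip: y_def)
        (metis mult_smult_assoc_mat mult_smult_distrib)
  qed
  have "\<delta> g * T = perm_block n m (\<lambda>i. Suc i mod n) (\<lambda>i. D g i * (if Suc i = n then U else 1\<^sub>m m))"
    unfolding \<delta>_eq T_eq
    by (rule perm_block_mult) (use U_GL GL_carrier_mat D_GL[OF g] in auto)
  \<comment> \<open>In the last row \<open>Suc i mod n\<close> is 0, and block 0 of \<phi>(g) is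
    untwisted, so \<open>wrap\<close> applies; all other rows follow from
    \<open>step\<close>.\<close>
  also have "\<dots> = perm_block n m (\<lambda>i. Suc i mod n)
      (\<lambda>i. (if Suc i = n then U else 1\<^sub>m m) * D (\<phi> g) (Suc i mod n))"
    using step wrap D_0[OF \<phi>g] right_mult_one_mat[OF GL_carrier_mat[OF D_GL[OF g]]]
      left_mult_one_mat[OF GL_carrier_mat[OF D_GL[OF g]]]
    by (intro perm_block_cong) (auto simp: mod_Suc)
  also have "\<dots> = T * \<delta> (\<phi> g)"
    unfolding \<delta>_eq T_eq
    by (rule perm_block_mult[symmetric]) (use n_pos U_GL GL_carrier_mat D_GL[OF \<phi>g] in auto)
  finally show ?thesis .
qed

text \<open>Row 0 already decides: on the left its block is \<open>U\<close> to the power l div n in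
  column l mod n, on the right it is \<sigma> c in column 0.\<close>

lemma T_pow_eq_\<delta>:
  assumes "card X \<noteq> 1" and c: "c \<in> carrier F" and eq: "T [^]\<^bsub>GL (m * n)\<^esub> (l::nat) = \<delta> c"
  shows "l = 0 \<and> c = \<one>\<^bsub>F\<^esub>"
proof -
  define q where "q = l div n"
  have "perm_block n m (\<lambda>i. (i + l) mod n) (\<lambda>i. U [^]\<^bsub>GL m\<^esub> ((i + l) div n)) =
      perm_block n m (\<lambda>i. i) (D c)"
    using eq perm_block_shift_pow[OF U_GL n_pos] by (simp add: T_eq \<delta>_eq)
  from perm_block_inject[OF this m_pos n_pos]
  have l: "l mod n = 0" and "U [^]\<^bsub>GL m\<^esub> q = \<sigma> c"
    using n_pos c D_GL[OF c] GL.nat_pow_closed[OF U_GL] D_0[OF c] by (auto simp: q_def)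
  then have \<sigma>c: "\<sigma> c = s ^ q \<cdot>\<^sub>m \<sigma> (f [^]\<^bsub>F\<^esub> q)"
    using f_carrier by (simp add: U_def smult_GL_pow \<sigma>.hom_nat_pow)
  define d where "d = c \<otimes>\<^bsub>F\<^esub> inv\<^bsub>F\<^esub> (f [^]\<^bsub>F\<^esub> q)"
  have d: "d \<in> carrier F" using c f_carrier by (simp add: d_def)
  have fq: "f [^]\<^bsub>F\<^esub> q \<in> carrier F" using f_carrier by simp
  have "\<sigma> d = s ^ q \<cdot>\<^sub>m (\<sigma> (f [^]\<^bsub>F\<^esub> q) * \<sigma> (inv\<^bsub>F\<^esub> (f [^]\<^bsub>F\<^esub> q)))"
    using c fq \<sigma>c \<sigma>.hom_mult GL_carrier_mat[OF \<sigma>.hom_closed[OF fq]]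
      GL_carrier_mat[OF \<sigma>.hom_closed[OF F.inv_closed[OF fq]]]
    by (simp add: d_def mult_smult_assoc_mat[of _ m m _ m] del: \<sigma>.hom_inv)
  also have "\<sigma> (f [^]\<^bsub>F\<^esub> q) * \<sigma> (inv\<^bsub>F\<^esub> (f [^]\<^bsub>F\<^esub> q)) = 1\<^sub>m m"
    using \<sigma>.hom_mult[OF fq F.inv_closed[OF fq]] fq \<sigma>.hom_one by (simp del: \<sigma>.hom_inv)
  finally have \<sigma>d: "\<sigma> d = s ^ q \<cdot>\<^sub>m 1\<^sub>m m" .
  have "d = \<one>\<^bsub>F\<^esub>"
  proof (rule free_group_center_trivial[OF assms(1) d])
    fix x assume "x \<in> X"
    then have x: "free_gen X x \<in> carrier F" by simp
    have "\<sigma> (d \<otimes>\<^bsub>F\<^esub> free_gen X x) = \<sigma> (free_gen X x \<otimes>\<^bsub>F\<^esub> d)"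
      using d x GL_carrier_mat[OF \<sigma>.hom_closed[OF x]]
      by (simp add: \<sigma>d mult_smult_distrib[of _ m m _ m] mult_smult_assoc_mat[of _ m m _ m])
    then show "d \<otimes>\<^bsub>F\<^esub> free_gen X x = free_gen X x \<otimes>\<^bsub>F\<^esub> d"
      by (rule inj_onD[OF \<sigma>_inj]) (use d x in auto)
  qed
  then have "s ^ q \<cdot>\<^sub>m 1\<^sub>m m = 1\<^sub>m m"
    using \<sigma>d \<sigma>.hom_one by simp
  \<comment> \<open>The entry (0, 0) exists because m > 0, and it reduces the matrix identity to one
    in the field.\<close>
  then have "(s ^ q \<cdot>\<^sub>m 1\<^sub>m m) $$ (0, 0) = (1\<^sub>m m :: 'p mat) $$ (0, 0)" by simp
  then have "s ^ q = 1" using m_pos by simp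
  then have "q = 0" using s_order by auto
  moreover have "l = 0"
    using l \<open>q = 0\<close> by (metis q_def div_mult_mod_eq mult_0 add_0)
  moreover have "c = d \<otimes>\<^bsub>F\<^esub> f [^]\<^bsub>F\<^esub> q"
    using c fq by (simp add: d_def F.m_assoc)
  ultimately show ?thesis using \<open>d = \<one>\<^bsub>F\<^esub>\<close> by simp
qed

section \<open>Lifting to the extension and computing the kernel\<close>

lemma ex_hnn_rep:
  obtains \<tau> where "\<tau> \<in> hom H (GL (m * n))" "\<tau> (hnn_gen X \<phi> None) = T"
    "\<And>x. x \<in> X \<Longrightarrow> \<tau> (hnn_gen X \<phi> (Some x)) = \<delta> (free_gen X x)"
proof -
  define h where "h = case_option T (\<lambda>x. \<delta> (free_gen X x))"
  have \<delta>_GL: "\<delta> g \<in> carrier (GL (m * n))" if "g \<in> carrier F" for g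
    using hom_in_carrier[OF \<delta>_hom that] .
  have h: "h \<in> hnn_gens X \<rightarrow> carrier (GL (m * n))"
    using T_GL \<delta>_GL by (auto simp: h_def hnn_gens_def)
  have rels: "word_eval (GL (m * n)) h l = word_eval (GL (m * n)) h r"
    if lr: "(l, r) \<in> hnn_rels X \<phi>" for l r
  proof -
    obtain x w where x: "x \<in> X" and w: "w \<in> \<phi> (free_gen X x)"
      and l: "l = [(None, False), (Some x, True), (None, True)]" and r: "r = map (apfst Some) w"
      using lr by (auto simp: hnn_rels_def)
    let ?g = "free_gen X x"
    have g: "?g \<in> carrier F" using x by simp
    then have \<phi>g: "\<phi> ?g \<in> carrier F" by (rule AutoGroup_apply_closed[OF aut])
    have "word_eval (GL (m * n)) h r = word_eval (GL (m * n)) (\<delta> \<circ> free_gen X) w"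
      by (simp add: r word_eval_map_apfst h_def comp_def)
    also have "\<dots> = \<delta> (\<phi> ?g)"
      using hom_pres_class[OF GL.group_axioms \<delta>_hom] pres_class_of_member[OF \<phi>g w] by simp
    \<comment> \<open>Inserting T^-1 T brings the expression into the form to which
      \<open>\<delta>_mult_T\<close> applies.\<close>
    also have "\<dots> = inv\<^bsub>GL (m * n)\<^esub> T \<otimes>\<^bsub>GL (m * n)\<^esub> (T \<otimes>\<^bsub>GL (m * n)\<^esub> \<delta> (\<phi> ?g))"
      using T_GL \<delta>_GL[OF \<phi>g] by (simp only: GL.m_assoc[symmetric] GL.inv_closed GL.l_inv GL.l_one)
    also have "\<dots> = inv\<^bsub>GL (m * n)\<^esub> T \<otimes>\<^bsub>GL (m * n)\<^esub> (\<delta> ?g \<otimes>\<^bsub>GL (m * n)\<^esub> T)"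
      using \<delta>_mult_T[OF g] by simp
    also have "\<dots> = word_eval (GL (m * n)) h l"
      using GL_carrier_mat[OF T_GL] by (simp add: l h_def)
    finally show ?thesis ..
  qed
  obtain \<tau> where "\<tau> \<in> hom H (GL (m * n))"
    "\<And>y. y \<in> hnn_gens X \<Longrightarrow> \<tau> (hnn_gen X \<phi> y) = h y"
    using presented_group_lift[OF GL.group_axioms h, of "hnn_rels X \<phi>"] rels by blast
  then show thesis by (intro that[of \<tau>]) (auto simp: hnn_gens_def h_def)
qed

lemma hnn_rep_inj:
  assumes X: "card X \<noteq> 1" and \<tau>: "\<tau> \<in> hom H (GL (m * n))" "\<tau> (hnn_gen X \<phi> None) = T"
    "\<And>x. x \<in> X \<Longrightarrow> \<tau> (hnn_gen X \<phi> (Some x)) = \<delta> (free_gen X x)"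
  shows "inj_on \<tau> (carrier H)"
proof -
  let ?GL = "GL (m * n) :: 'p mat monoid"
  define t where "t = hnn_gen X \<phi> None"
  have t: "t \<in> carrier H" by (simp add: t_def hnn_gens_def)
  interpret \<tau>: group_hom H ?GL \<tau>
    using \<tau>(1) by (simp add: group_hom_def group_hom_axioms_def H.group_axioms GL.group_axioms)
  interpret \<delta>: group_hom F ?GL \<delta>
    using \<delta>_hom by (simp add: group_hom_def group_hom_axioms_def F.group_axioms GL.group_axioms)
  obtain \<iota> where \<iota>: "\<iota> \<in> hom F H"
    "\<And>x. x \<in> X \<Longrightarrow> \<iota> (free_gen X x) = hnn_gen X \<phi> (Some x)"
    and nf: "\<And>h. h \<in> carrier H \<Longrightarrow> \<exists>g \<in> carrier F. \<exists>k::int. h = \<iota> g \<otimes>\<^bsub>H\<^esub> t [^]\<^bsub>H\<^esub> k"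
    using hnn_normal_form[OF aut] unfolding t_def by blast
  interpret \<iota>: group_hom F H \<iota>
    using \<iota>(1) by (simp add: group_hom_def group_hom_axioms_def F.group_axioms H.group_axioms)
  \<comment> \<open>Identifies \<tau> on the image of F(X) with the explicit block diagonal
    formula.\<close>
  have \<tau>\<iota>: "\<tau> (\<iota> g) = \<delta> g" if "g \<in> carrier F" for g
    by (rule presented_group_hom_eqI[OF GL.group_axioms _ \<delta>_hom _ that])
      (use hom_compose[OF \<iota>(1) \<tau>(1)] \<iota>(2) \<tau>(3) in \<open>simp_all add: comp_def\<close>)
  have "h = \<one>\<^bsub>H\<^esub>" if h: "h \<in> carrier H" and ker: "\<tau> h = \<one>\<^bsub>?GL\<^esub>" for h
  proof -
    obtain g and k :: int where g: "g \<in> carrier F" and hk: "h = \<iota> g \<otimes>\<^bsub>H\<^esub> t [^]\<^bsub>H\<^esub> k"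
      using nf[OF h] by blast
    have Tk: "T [^]\<^bsub>?GL\<^esub> k \<in> carrier ?GL" using T_GL by (rule GL.int_pow_closed)
    have "\<delta> g \<otimes>\<^bsub>?GL\<^esub> T [^]\<^bsub>?GL\<^esub> k = \<one>\<^bsub>?GL\<^esub>"
      using ker \<tau>.hom_mult[of "\<iota> g" "t [^]\<^bsub>H\<^esub> k"] \<tau>.hom_int_pow[OF t, of k] \<tau>\<iota>[OF g] g t \<tau>(2)
      by (simp add: hk t_def del: GL_mult GL_one)
    then have \<delta>g: "\<delta> g = inv\<^bsub>?GL\<^esub> (T [^]\<^bsub>?GL\<^esub> k)"
      using GL.inv_equality[OF _ Tk \<delta>.hom_closed[OF g]] by simp
    have "k = 0 \<and> g = \<one>\<^bsub>F\<^esub>"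
    \<comment> \<open>\<open>T_pow_eq_\<delta>\<close> takes natural exponents: for k >= 0 it is
      applied to the inverse of \<open>g\<close>, otherwise to \<open>g\<close> and the exponent
      -k.\<close>
    proof (cases "k \<ge> 0")
      case True
      then obtain l where l: "k = int l" by (metis zero_le_imp_eq_int)
      have "T [^]\<^bsub>?GL\<^esub> l = \<delta> (inv\<^bsub>F\<^esub> g)"
        using \<delta>g Tk by (simp add: \<delta>.hom_inv[OF g] l int_pow_int)
      then have "l = 0 \<and> inv\<^bsub>F\<^esub> g = \<one>\<^bsub>F\<^esub>"
        by (rule T_pow_eq_\<delta>[OF X F.inv_closed[OF g]])
      then show ?thesis using l g F.inv_eq_1_iff by simp
    next
      case False
      then obtain l where l: "k = - int l" by (metis int_cases2 of_nat_0_le_iff)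
      have "T [^]\<^bsub>?GL\<^esub> l = \<delta> g"
        using \<delta>g T_GL GL.nat_pow_closed[OF T_GL, of l] by (simp add: l GL.int_pow_neg_int)
      then show ?thesis using T_pow_eq_\<delta>[OF X g] l by simp
    qed
    then show ?thesis by (simp add: hk)
  qed
  then show ?thesis using \<tau>.inj_on_one_iff by blast
qed

end

theorem theorem2:
  fixes X :: "'a set"
    and \<phi> :: "'a word set \<Rightarrow> 'a word set"
    and f :: "'a word set"
    and \<sigma> :: "'a word set \<Rightarrow> 'p::field mat"
    and s :: 'p
    and m n :: nat
  assumes m_pos: "m > 0"
    and n_pos: "n > 0"
    and aut: "\<phi> \<in> carrier (AutoGroup (free_group X))"
    and inner: "\<phi> [^]\<^bsub>AutoGroup (free_group X)\<^esub> n \<in> Inn (free_group X)"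
    and f_carrier: "f \<in> carrier (free_group X)"
    and f_conj: "\<forall>x\<in>X. (\<phi> [^]\<^bsub>AutoGroup (free_group X)\<^esub> n) (free_gen X x) =
        inv\<^bsub>free_group X\<^esub> f \<otimes>\<^bsub>free_group X\<^esub> free_gen X x \<otimes>\<^bsub>free_group X\<^esub> f"
    and faithful: "\<sigma> \<in> mon (free_group X) (GL m)"
    and s_unit: "s \<noteq> 0"
    and s_order: "\<forall>k::nat. k > 0 \<longrightarrow> s ^ k \<noteq> 1"
  shows "\<exists>\<tau> \<in> hom (hnn_group X \<phi>) (GL (m * n)).
      \<tau> (hnn_gen X \<phi> None) = block_shift_mat n m s (\<sigma> f) \<and>
      (\<forall>x\<in>X. \<tau> (hnn_gen X \<phi> (Some x)) =
        block_diag_mat n m (\<lambda>i. \<sigma> ((\<phi> [^]\<^bsub>AutoGroup (free_group X)\<^esub> (- int i)) (free_gen X x)))) \<and>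
      (card X \<noteq> 1 \<longrightarrow> inj_on \<tau> (carrier (hnn_group X \<phi>)))"
proof -
  interpret virtually_inner_rep X \<phi> f \<sigma> s m n
    using m_pos n_pos aut f_carrier f_conj faithful s_unit s_order by unfold_locales
  obtain \<tau> where \<tau>: "\<tau> \<in> hom H (GL (m * n))" "\<tau> (hnn_gen X \<phi> None) = T"
    "\<And>x. x \<in> X \<Longrightarrow> \<tau> (hnn_gen X \<phi> (Some x)) = \<delta> (free_gen X x)"
    using ex_hnn_rep by blast
  then show ?thesis
    using hnn_rep_inj[OF _ \<tau>] unfolding T_def \<delta>_def D_def by blast
qed

end
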